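(* Let $q=4$ and $n=1+q^a+q^b+q^e+q^{e+k}$, where $a,b,e,k$ are positive integers. Then $$g_{n,q}\equiv S_aS_b+(S_a+S_b+S_e)S_k+S_e^2\pmod{X^{q^e}-X}.$$ If $\gcd(e,2k)=1$ and ($a=k$ or $b=k$), then $g_{n,q}$ is a permutation polynomial of $\mathbb F_{q^e}$.
   Context: For a prime power $q$ with $p=\operatorname{char}\mathbb F_q$ and an integer $n\ge 0$, $g_{n,q}\in\mathbb F_p[X]$ is the polynomial defined by the functional equation $\sum_{c\in\mathbb F_q}(X+c)^n=g_{n,q}(X^q-X)$. For each integer $a\ge 0$, $S_a=X+X^q+\cdots+X^{q^{a-1}}$ (with $S_0=0$). Products and powers of the $S_a$ are ordinary products and powers of polynomials. A polynomial over a finite field $F$ is a permutation polynomial of $F$ if it induces a bijection $F\to F$. *)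

theory Defs
  imports
    "HOL-Algebra.Algebraic_Closure_Type"
    "HOL-Computational_Algebra.Computational_Algebra"
    "HOL-Number_Theory.Cong"
    "HOL-Library.Z2"
begin

text \<open>
  All finite fields of characteristic p live in one algebraic closure of the prime field, which is
  the type parameter: for q a power of p, the field with q elements is the set of roots of
  X^q - X, i.e. the unique subfield of order q (lemmas \<open>GF_closed\<close>, \<open>card_GF\<close>, \<open>subfield_eq_GF\<close>).
  For the meaning intended here, the parameter has to be instantiated with a prime field, such as
  \<^typ>\<open>bit\<close> for p = 2.
\<close>

definition GF :: "nat \<Rightarrow> 'p::field alg_closure set" where
  "GF q = {x. x ^ q = x}"

definition lift_ac :: "'p::field poly \<Rightarrow> 'p alg_closure poly" where
  "lift_ac f = map_poly to_ac f"

definition Xq_minus_X :: "nat \<Rightarrow> 'a::comm_ring_1 poly" where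
  "Xq_minus_X q = monom 1 q - monom 1 1"

text \<open>
  The functional equation that determines g is an identity over the field with q elements, hence
  the lifting of g. The lemma \<open>ex1_g_poly\<close> below shows that the description is proper.
\<close>

definition g_poly :: "nat \<Rightarrow> nat \<Rightarrow> 'p::field poly" where
  "g_poly n q = (THE g. (\<Sum>c\<in>GF q. [:c, 1:] ^ n) = pcompose (lift_ac g) (Xq_minus_X q))"

definition S_poly :: "nat \<Rightarrow> nat \<Rightarrow> 'p::field poly" where
  "S_poly q a = (\<Sum>i<a. monom 1 (q ^ i))"

definition permutation_poly_on :: "'a::comm_ring_1 set \<Rightarrow> 'a poly \<Rightarrow> bool" where
  "permutation_poly_on F f \<longleftrightarrow> bij_betw (poly f) F F"


subsection \<open>The finite subfields\<close>

lemma GF_eq_roots: "GF q = {x. poly (Xq_minus_X q) x = 0}"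
  by (auto simp: GF_def Xq_minus_X_def poly_monom)

lemma degree_Xq_minus_X: "q > 1 \<Longrightarrow> degree (Xq_minus_X q :: 'a::comm_ring_1 poly) = q"
  unfolding Xq_minus_X_def
  by (subst diff_conv_add_uminus, subst degree_add_eq_left)
     (auto simp: degree_monom_eq)

lemma GF_closed:
  fixes x y :: "'p::field alg_closure"
  assumes "prime CHAR('p)" "q = CHAR('p) ^ m" "x \<in> GF q" "y \<in> GF q"
  shows "0 \<in> (GF q :: 'p alg_closure set)" "1 \<in> (GF q :: 'p alg_closure set)"
    "x + y \<in> GF q" "- x \<in> GF q" "x * y \<in> GF q" "inverse x \<in> GF q"
proof -
  have q0: "q > 0" using assms(1,2) prime_gt_0_nat by auto
  show 0: "0 \<in> (GF q :: 'p alg_closure set)" "1 \<in> (GF q :: 'p alg_closure set)"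
    using q0 by (auto simp: GF_def)
  have add: "(u + v) ^ q = u ^ q + v ^ q" for u v :: "'p alg_closure"
    using freshmans_dream'[of q m u v] assms(1,2) by simp
  show "x + y \<in> GF q" "x * y \<in> GF q" "inverse x \<in> GF q"
    using assms(3,4) by (auto simp: GF_def add power_mult_distrib power_inverse)
  have "x ^ q + (- x) ^ q = 0"
    using add[of x "- x"] q0 by (simp add: zero_power)
  thus "- x \<in> GF q"
    using assms(3) by (auto simp: GF_def add_eq_0_iff)
qed

lemma card_GF:
  fixes q :: nat
  assumes p: "prime CHAR('p)" and q: "q = CHAR('p) ^ m" and m: "m > 0"
  shows "finite (GF q :: 'p::field alg_closure set)" "card (GF q :: 'p alg_closure set) = q"
proof -
  let ?P = "Xq_minus_X q :: 'p alg_closure poly"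
  have q1: "q > 1" using p q m by (metis one_less_power prime_gt_1_nat)
  have P0: "?P \<noteq> 0" using degree_Xq_minus_X[OF q1, where 'a = "'p alg_closure"] q1 by auto
  show "finite (GF q :: 'p alg_closure set)"
    unfolding GF_eq_roots using P0 by (rule poly_roots_finite)
  have "of_nat q = (0 :: 'p alg_closure)"
    unfolding of_nat_eq_0_iff_char_dvd using q m by simp
  hence pd: "pderiv ?P = -1"
    by (simp add: Xq_minus_X_def pderiv_diff pderiv_monom one_pCons monom_0)
  have "\<exists>A. size A = degree ?P \<and> ?P = smult (lead_coeff ?P) (\<Prod>x\<in>#A. [:-x, 1:])"
    using alg_closed_imp_factorization[OF P0] by auto
  then obtain A where A: "size A = degree ?P"
    "?P = smult (lead_coeff ?P) (\<Prod>x\<in>#A. [:-x, 1:])" by blast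
  have "set_mset A = GF q"
  proof -
    have "poly ?P x = lead_coeff ?P * (\<Prod>y\<in>#A. x - y)" for x
      by (subst A(2)) (simp add: poly_prod_mset)
    thus ?thesis using P0 by (auto simp: GF_eq_roots)
  qed
  moreover have "count A x \<le> 1" for x
  proof (rule ccontr)
    assume "\<not> count A x \<le> 1"
    hence "replicate_mset 2 x \<subseteq># A" by (simp flip: count_le_replicate_mset_subset_eq)
    then obtain B where "A = replicate_mset 2 x + B" by (meson mset_subset_eq_exists_conv)
    hence "[:-x, 1:] ^ 2 dvd ?P"
      by (subst A(2)) (auto intro!: dvd_smult)
    then obtain r where "?P = [:-x, 1:] ^ 2 * r" by (elim dvdE)
    hence "poly (pderiv ?P) x = 0"
      by (simp add: pderiv_mult power2_eq_square del: mult_pCons_left mult_pCons_right)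
    thus False by (simp add: pd)
  qed
  hence "A = mset_set (set_mset A)"
    by (intro multiset_eqI) (metis One_nat_def count_mset_set(1,3) count_greater_zero_iff
      finite_set_mset le_antisym not_gr_zero Suc_leI)
  ultimately show "card (GF q :: 'p alg_closure set) = q"
    using A(1) degree_Xq_minus_X[OF q1] by (metis size_mset_set)
qed

lemma subfield_eq_GF:
  fixes K :: "'p::field alg_closure set"
  assumes p: "prime CHAR('p)" and q: "q = CHAR('p) ^ m" and m: "m > 0"
    and K: "card K = q" "0 \<in> K" "\<And>x y. x \<in> K \<Longrightarrow> y \<in> K \<Longrightarrow> x * y \<in> K"
  shows "K = GF q"
proof (rule card_subset_eq[OF card_GF(1)[OF p q m]])
  have q1: "q > 1" using p q m by (metis one_less_power prime_gt_1_nat)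
  hence fin: "finite K" using K(1) card.infinite by fastforce
  show "K \<subseteq> GF q"
  proof
    fix x assume x: "x \<in> K"
    show "x \<in> GF q"
    proof (cases "x = 0")
      case False
      have inj: "inj_on (\<lambda>y. x * y) (K - {0})" using False by (auto simp: inj_on_def)
      have "(\<lambda>y. x * y) ` (K - {0}) = K - {0}"
        using fin inj x False K(3) by (intro endo_inj_surj) auto
      hence "(\<Prod>y\<in>K - {0}. y) = (\<Prod>y\<in>K - {0}. x * y)"
        using prod.reindex[OF inj, of "\<lambda>y. y"] by simp
      also have "\<dots> = x ^ (q - 1) * (\<Prod>y\<in>K - {0}. y)"
        using K(1,2) fin by (simp add: prod.distrib card_Diff_singleton)
      finally have "x ^ (q - 1) = 1" using fin by (simp add: prod_zero_iff)
      hence "x * x ^ (q - 1) = x" by simp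
      thus ?thesis using q1 by (simp add: GF_def flip: power_Suc)
    qed (use q1 in \<open>auto simp: GF_def\<close>)
  qed
  show "card K = card (GF q :: 'p alg_closure set)" using K(1) card_GF(2)[OF p q m] by simp
qed


subsection \<open>The polynomial g exists and is unique\<close>

lemma lift_ac_simps [simp]:
  "lift_ac 0 = 0" "lift_ac (f + g) = lift_ac f + lift_ac g" "lift_ac (pCons c f) = pCons (to_ac c) (lift_ac f)"
  by (auto simp: lift_ac_def poly_eq_iff coeff_map_poly coeff_pCons split: nat.splits)

lemma lift_ac_eq_iff [simp]: "lift_ac f = lift_ac g \<longleftrightarrow> f = g"
  by (auto simp: lift_ac_def poly_eq_iff coeff_map_poly)

lemma sum_powers_GF:
  assumes p: "prime CHAR('p)" and q: "q = CHAR('p) ^ m" and m: "m > 0" and j: "j < q - 1"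
  shows "(\<Sum>c\<in>GF q. c ^ j) = (0 :: 'p::field alg_closure)"
proof (cases "j = 0")
  case True
  have "of_nat q = (0 :: 'p alg_closure)"
    unfolding of_nat_eq_0_iff_char_dvd using q m by simp
  thus ?thesis using True card_GF[OF p q m] by simp
next
  case False
  let ?F = "GF q :: 'p alg_closure set"
  have q1: "q > 1" using p q m by (metis one_less_power prime_gt_1_nat)
  note fin = card_GF(1)[OF p q m]
  have "\<exists>d\<in>?F. d \<noteq> 0 \<and> d ^ j \<noteq> 1"
  proof (rule ccontr)
    assume "\<not> ?thesis"
    hence sub: "?F - {0} \<subseteq> {x. poly (monom 1 j - 1) x = 0}"
      by (auto simp: poly_monom)
    have deg: "degree (monom 1 j - 1 :: 'p alg_closure poly) = j"
      using False by (subst diff_conv_add_uminus, subst degree_add_eq_left)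
        (auto simp: degree_monom_eq)
    hence nz: "monom 1 j - 1 \<noteq> (0 :: 'p alg_closure poly)" using False by auto
    have "card (?F - {0}) \<le> j"
      using card_mono[OF poly_roots_finite[OF nz] sub] card_poly_roots_bound[OF nz] deg by linarith
    moreover have "card (?F - {0}) = q - 1"
      using fin card_GF(2)[OF p q m] q1 by (subst card_Diff_singleton) (auto simp: GF_def)
    ultimately show False using j by simp
  qed
  then obtain d where d: "d \<in> ?F" "d \<noteq> 0" "d ^ j \<noteq> 1" by blast
  have "bij_betw (\<lambda>c. d * c) ?F ?F"
    by (rule bij_betwI[where g = "\<lambda>c. inverse d * c"])
       (use d in \<open>auto simp: GF_def power_mult_distrib power_inverse\<close>)
  hence "(\<Sum>c\<in>?F. c ^ j) = (\<Sum>c\<in>?F. (d * c) ^ j)"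
    by (rule sum.reindex_bij_betw[symmetric])
  also have "\<dots> = d ^ j * (\<Sum>c\<in>?F. c ^ j)"
    by (simp add: power_mult_distrib sum_distrib_left)
  finally show ?thesis using d(3) by auto
qed

lemma sum_powers_GF_last:
  assumes p: "prime CHAR('p)" and q: "q = CHAR('p) ^ m" and m: "m > 0"
  shows "(\<Sum>c\<in>GF q. c ^ (q - 1)) = (-1 :: 'p::field alg_closure)"
proof -
  let ?F = "GF q :: 'p alg_closure set"
  have q1: "q > 1" using p q m by (metis one_less_power prime_gt_1_nat)
  note fin = card_GF(1)[OF p q m]
  have "(\<Sum>c\<in>?F. c ^ (q - 1)) = (\<Sum>c\<in>?F - {0}. c ^ (q - 1))"
    using fin q1 by (intro sum.mono_neutral_right) auto
  also have "\<dots> = (\<Sum>c\<in>?F - {0}. 1)"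
  proof (rule sum.cong, goal_cases)
    case (2 c)
    hence "c * c ^ (q - 1) = c * 1" using q1 by (simp add: GF_def flip: power_Suc)
    thus ?case using 2 by (simp del: power_Suc)
  qed auto
  also have "\<dots> = of_nat (q - 1)"
    using fin card_GF(2)[OF p q m] q1 by (simp add: card_Diff_singleton GF_def)
  also have "\<dots> = of_nat q - 1" using q1 by (simp add: of_nat_diff)
  also have "of_nat q = (0 :: 'p alg_closure)"
    unfolding of_nat_eq_0_iff_char_dvd using q m by simp
  finally show ?thesis by simp
qed

lemma ex_g_poly:
  assumes p: "prime CHAR('p)" and q: "q = CHAR('p) ^ m" and m: "m > 0"
  shows "\<exists>g :: 'p::field poly.
    (\<Sum>c\<in>GF q. [:c, 1:] ^ n) = pcompose (lift_ac g) (Xq_minus_X q)"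
proof (induction n rule: less_induct)
  case (less n)
  have q1: "q > 1" using p q m by (metis one_less_power prime_gt_1_nat)
  show ?case
  proof (cases "n < q")
    case True
    have last: "of_nat (n choose (q - Suc 0)) * (\<Sum>c\<in>GF q. (c :: 'p alg_closure) ^ (q - Suc 0)) = -1"
      if "q - Suc 0 \<le> n"
    proof -
      have "n = q - Suc 0" using that True by simp
      thus ?thesis using sum_powers_GF_last[OF p q m] by simp
    qed
    have "[:c, 1:] ^ n = (\<Sum>k\<le>n. monom (of_nat (n choose k) * c ^ k) (n - k))"
      for c :: "'p alg_closure"
    proof -
      have "[:c, 1:] = [:c:] + monom 1 1" by (simp add: monom_altdef)
      thus ?thesis by (simp add: binomial_ring monom_power poly_const_pow smult_monom
            of_nat_poly mult.commute)
    qed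
    hence "(\<Sum>c\<in>GF q. [:c, 1:] ^ n) =
        (\<Sum>k\<le>n. monom (of_nat (n choose k) * (\<Sum>c\<in>GF q. (c :: 'p alg_closure) ^ k)) (n - k))"
      by (simp add: sum.swap[of _ "{..n}"] sum_distrib_left monom_sum)
    also have "\<dots> = (\<Sum>k\<le>n. if k = q - 1 then monom (-1) 0 else 0)"
      using True by (intro sum.cong) (auto simp: sum_powers_GF[OF p q m]
          last)
    also have "\<dots> = (if n = q - 1 then -1 else 0)"
      using True q1 by (auto simp: monom_0 one_pCons)
    also have "\<dots> = pcompose (lift_ac (if n = q - 1 then [:-1:] else 0)) (Xq_minus_X q)"
      by (auto simp: pcompose_pCons one_pCons)
    finally show ?thesis by blast
  next
    case False
    define r where "r = n - q"
    have n: "n = r + q" using False by (simp add: r_def)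
    obtain g h :: "'p poly" where
      g: "(\<Sum>c\<in>GF q. [:c, 1:] ^ (r + 1)) = pcompose (lift_ac g) (Xq_minus_X q)" and
      h: "(\<Sum>c\<in>GF q. [:c, 1:] ^ r) = pcompose (lift_ac h) (Xq_minus_X q)"
      using less[of "r + 1"] less[of r] q1 n by auto
    have "[:c, 1:] ^ n = [:c, 1:] ^ (r + 1) + Xq_minus_X q * [:c, 1:] ^ r"
      if "c \<in> GF q" for c :: "'p alg_closure"
    proof -
      have "[:c, 1:] ^ q = ([:c:] + monom 1 1) ^ q" by (simp add: monom_altdef)
      also have "\<dots> = [:c:] ^ q + monom 1 1 ^ q"
        using freshmans_dream'[of q m "[:c:]" "monom 1 1"] p q by simp
      also have "\<dots> = [:c, 1:] + Xq_minus_X q"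
        using that by (simp add: GF_def poly_const_pow monom_power Xq_minus_X_def)
          (simp add: monom_altdef)
      finally show ?thesis by (simp add: n power_add algebra_simps)
    qed
    hence "(\<Sum>c\<in>GF q. [:c, 1:] ^ n) =
        pcompose (lift_ac (g + pCons 0 h)) (Xq_minus_X q)"
      by (simp add: sum.distrib pcompose_add pcompose_pCons flip: sum_distrib_left g h)
    thus ?thesis by blast
  qed
qed

lemma ex1_g_poly:
  assumes p: "prime CHAR('p)" and q: "q = CHAR('p) ^ m" and m: "m > 0"
  shows "\<exists>!g :: 'p::field poly.
    (\<Sum>c\<in>GF q. [:c, 1:] ^ n) = pcompose (lift_ac g) (Xq_minus_X q)"
proof -
  have q1: "q > 1" using p q m by (metis one_less_power prime_gt_1_nat)
  have "g = h" if "pcompose (lift_ac g) (Xq_minus_X q) = pcompose (lift_ac h) (Xq_minus_X q)"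
    for g h :: "'p poly"
  proof -
    have "pcompose (lift_ac g - lift_ac h) (Xq_minus_X q) = 0"
      using that by (simp add: pcompose_diff)
    hence "lift_ac g - lift_ac h = 0"
      by (rule pcompose_eq_0) (use q1 in \<open>simp add: degree_Xq_minus_X\<close>)
    thus ?thesis by simp
  qed
  with ex_g_poly[OF p q m, of n] show ?thesis by metis
qed

lemma g_poly_functional_equation:
  assumes "prime CHAR('p)" "q = CHAR('p) ^ m" "m > 0"
  shows "(\<Sum>c\<in>GF q. [:c, 1:] ^ n) = pcompose (lift_ac (g_poly n q :: 'p::field poly)) (Xq_minus_X q)"
  unfolding g_poly_def by (rule theI'[OF ex1_g_poly[OF assms]])

lemma CHAR_bit: "CHAR(bit) = 2"
proof (rule CHAR_eqI)
  show "of_nat 2 = (0 :: bit)" by simp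
  show "2 dvd n" if "of_nat n = (0 :: bit)" for n :: nat
  proof (rule ccontr)
    assume "\<not> 2 dvd n"
    then obtain k where "n = 2 * k + 1" by (elim oddE)
    thus False using that by simp
  qed
qed

end

theory Submission
  imports Defs
begin

text \<open>
  Write \<open>y = X ^ q - X\<close>. Since every \<open>c\<close> in the field with \<open>q\<close> elements is fixed by the
  \<open>q\<close>-th power map, \<open>(X + c) ^ (q ^ i) = X ^ (q ^ i) + c\<close>, so for \<open>n = 1 + q ^ a + q ^ b + q ^ d + q ^ f\<close>
  the sum defining \<open>g\<close> is \<open>\<Sum>c. \<Prod>i. (x\<^sub>i + c)\<close> for five polynomials \<open>x\<^sub>i\<close>. For \<open>q = 4\<close> the power sums
  \<open>\<Sum>c. c ^ j\<close> with \<open>j \<le> 5\<close> vanish except for \<open>j = 3\<close>, where the value is \<open>-1 = 1\<close>; hence only the second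
  elementary symmetric polynomial of the \<open>x\<^sub>i\<close> survives. In characteristic 2 that polynomial in five
  variables is invariant under a common translation, because the coefficients 10 and 4 vanish.
  Translating by \<open>X\<close> replaces the \<open>x\<^sub>i\<close> by 0 and the differences \<open>X ^ (q ^ i) - X = S\<^sub>i(y)\<close>.
  This gives an exact formula (lemma \<open>g_poly_digit_sum_5\<close>): \<open>g\<close> is the second elementary symmetric
  polynomial in \<open>S\<^sub>a, S\<^sub>b, S\<^sub>d, S\<^sub>f\<close>. The congruence follows from
  \<open>S\<^sub>e\<^sub>+\<^sub>k = S\<^sub>e + S\<^sub>k(X ^ (q ^ e))\<close>.

  When \<open>a = k\<close> or \<open>b = k\<close>, the right-hand side collapses to \<open>S\<^sub>k\<^sup>2 + S\<^sub>e S\<^sub>k + S\<^sub>e\<^sup>2\<close>, which is a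
  permutation polynomial by lemma \<open>bij_S_poly_quadratic\<close>. On the field with
  \<open>q ^ e\<close> elements \<open>S\<^sub>e\<close> is the trace \<open>T\<close> to the field with \<open>q\<close> elements, and
  \<open>T(S\<^sub>k(x)) = k T(x)\<close>. As \<open>e\<close> is odd, applying \<open>T\<close> to the value \<open>f(x)\<close> of this polynomial yields
  \<open>k T(x)\<^sup>2 + k T(x)\<^sup>2 + T(x)\<^sup>2 = T(x)\<^sup>2\<close>, so \<open>f(x)\<close> determines \<open>t = T(x)\<close>.
  If \<open>f(x) = f(y)\<close>, then \<open>z = x - y\<close> has trace 0, and \<open>d = S\<^sub>k(z)\<close> satisfies
  \<open>d\<^sup>2 + t d = 0\<close>; thus \<open>d\<close> is 0 or \<open>t\<close>, and in both cases it is fixed by the \<open>q\<close>-th power map. But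
  \<open>d ^ q - d = z ^ (q ^ k) - z\<close>, so \<open>z\<close> lies in the fields with \<open>q ^ k\<close> and \<open>q ^ e\<close> elements,
  hence, \<open>e\<close> and \<open>k\<close> being coprime, in the field with \<open>q\<close> elements. There the trace is multiplication
  by the odd number \<open>e\<close>, and \<open>T(z) = 0\<close> forces \<open>z = 0\<close>.
\<close>

section \<open>Frobenius powers\<close>

lemma diff_power_CHAR:
  fixes x y :: "'a::comm_ring_1"
  assumes "prime CHAR('a)" "q = CHAR('a) ^ m"
  shows "(x - y) ^ q = x ^ q - y ^ q"
  using freshmans_dream'[OF assms, of "x - y" y] by (simp add: algebra_simps)

lemma GF_power_power:
  assumes "x \<in> GF q"
  shows "x ^ (q ^ i) = x"
  using assms by (induction i) (auto simp: GF_def power_mult)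

text \<open>
  The exponents \<open>i\<close> for which \<open>x ^ (q ^ i) = x\<close> are closed under taking multiples, so a Bezout identity
  \<open>k u = e v + 1\<close> reduces the exponent to 1.
\<close>

lemma GF_power_Int_coprime:
  assumes "coprime k e" "k > 0" "x \<in> GF (q ^ k)" "x \<in> GF (q ^ e)"
  shows "x \<in> GF q"
proof -
  obtain u v where uv: "k * u = e * v + 1"
    using bezout_nat[of k e] assms(1,2) by (auto simp: coprime_iff_gcd_eq_1)
  have "x = x ^ (q ^ (k * u))"
    using GF_power_power[OF assms(3), of u] by (simp add: power_mult)
  also have "\<dots> = (x ^ (q ^ (e * v))) ^ q"
    by (simp add: uv mult.commute flip: power_mult)
  also have "\<dots> = x ^ q"
    using GF_power_power[OF assms(4), of v] by (simp add: power_mult)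
  finally show ?thesis by (simp add: GF_def)
qed

section \<open>Lifting and composition\<close>

lemma lift_ac_smult: "lift_ac (smult c f) = smult (to_ac c) (lift_ac f)"
  by (induction f) auto

lemma lift_ac_mult: "lift_ac (f * g) = lift_ac f * lift_ac g"
  by (induction f) (auto simp: lift_ac_smult)

lemma lift_ac_monom: "lift_ac (monom c n) = monom (to_ac c) n"
  by (simp add: lift_ac_def map_poly_monom)

lemma lift_ac_sum: "lift_ac (\<Sum>i\<in>A. f i) = (\<Sum>i\<in>A. lift_ac (f i))"
  by (induction A rule: infinite_finite_induct) auto

lemma lift_ac_S_poly: "lift_ac (S_poly q a) = S_poly q a"
  by (simp add: S_poly_def lift_ac_sum lift_ac_monom)

lemma lift_ac_Xq_minus_X: "lift_ac (Xq_minus_X q) = Xq_minus_X q"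
proof -
  have "lift_ac (Xq_minus_X q + monom 1 1) = Xq_minus_X q + monom 1 1"
    by (simp add: Xq_minus_X_def lift_ac_monom del: lift_ac_simps)
  thus ?thesis by (simp add: lift_ac_monom)
qed

lemma pcompose_monom_1: "pcompose (monom 1 n) p = p ^ n"
  by (induction n) (auto simp: monom_0 monom_Suc pcompose_pCons)

section \<open>The polynomials \<open>S\<close>\<close>

lemma poly_S_poly: "poly (S_poly q a) x = (\<Sum>i<a. x ^ (q ^ i))"
  by (simp add: S_poly_def poly_sum poly_monom)

text \<open>After substituting \<open>X ^ q - X\<close>, the terms of \<open>S\<close> telescope.\<close>

lemma pcompose_S_poly:
  assumes p: "prime CHAR('a)" and q: "q = CHAR('a) ^ m"
  shows "pcompose (S_poly q a) (Xq_minus_X q) = (monom 1 (q ^ a) - monom 1 1 :: 'a::field poly)"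
proof -
  have *: "Xq_minus_X q ^ (q ^ i) = (monom 1 (q ^ Suc i) - monom 1 (q ^ i) :: 'a poly)" for i
    unfolding Xq_minus_X_def
    by (subst diff_power_CHAR[of _ "m * i"])
       (use p q in \<open>simp_all add: power_mult monom_power\<close>)
  have "pcompose (S_poly q a) (Xq_minus_X q) =
      (\<Sum>i<a. monom 1 (q ^ Suc i) - monom 1 (q ^ i) :: 'a poly)"
    by (simp only: S_poly_def pcompose_sum pcompose_monom_1 *)
  also have "\<dots> = monom 1 (q ^ a) - monom 1 1"
    by (subst sum_lessThan_telescope) simp
  finally show ?thesis .
qed

lemma poly_S_poly_diff:
  fixes x y :: "'a::field"
  assumes "prime CHAR('a)" "q = CHAR('a) ^ m"
  shows "poly (S_poly q a) (x - y) = poly (S_poly q a) x - poly (S_poly q a) y"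
proof -
  have "(x - y) ^ (q ^ i) = x ^ (q ^ i) - y ^ (q ^ i)" for i
    by (rule diff_power_CHAR[of _ "m * i"]) (use assms in \<open>simp_all add: power_mult\<close>)
  thus ?thesis by (simp add: poly_S_poly sum_subtractf)
qed

lemma poly_S_poly_add:
  fixes x y :: "'a::field"
  assumes "prime CHAR('a)" "q = CHAR('a) ^ m"
  shows "poly (S_poly q a) (x + y) = poly (S_poly q a) x + poly (S_poly q a) y"
  using poly_S_poly_diff[OF assms, of a "x + y" y] by (simp add: algebra_simps)

lemma poly_S_poly_power:
  fixes x :: "'a::field"
  assumes "prime CHAR('a)" "r = CHAR('a) ^ m"
  shows "poly (S_poly q a) (x ^ r) = poly (S_poly q a) x ^ r"
  by (simp add: poly_S_poly freshmans_dream_sum'[OF assms] mult.commute flip: power_mult)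

lemma poly_S_poly_sum:
  fixes x :: "'b \<Rightarrow> 'a::field"
  assumes "prime CHAR('a)" "q = CHAR('a) ^ m"
  shows "poly (S_poly q a) (\<Sum>i\<in>A. x i) = (\<Sum>i\<in>A. poly (S_poly q a) (x i))"
proof (induction A rule: infinite_finite_induct)
  case (insert i A)
  thus ?case by (simp add: poly_S_poly_add[OF assms])
qed (use poly_S_poly_diff[OF assms, of a 0 0] in auto)

text \<open>
  The telescoping at a point: \<open>S\<^sub>a(x)\<close> is fixed by the \<open>q\<close>-th power map exactly if \<open>x\<close> is fixed by its
  \<open>a\<close>-th iterate. The case \<open>a = e\<close> shows that traces lie in the small field; the case \<open>a = k\<close> is
  what recovers \<open>x\<close> from \<open>S\<^sub>k(x)\<close> in the permutation argument.
\<close>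

lemma poly_S_poly_power_diff:
  fixes x :: "'a::field"
  assumes "prime CHAR('a)" "q = CHAR('a) ^ m"
  shows "poly (S_poly q a) x ^ q - poly (S_poly q a) x = x ^ (q ^ a) - x"
proof -
  have "poly (S_poly q a) x ^ q - poly (S_poly q a) x = poly (S_poly q a) (x ^ q - x)"
    by (simp add: poly_S_poly_diff[OF assms] poly_S_poly_power[OF assms])
  also have "\<dots> = poly (pcompose (S_poly q a) (Xq_minus_X q)) x"
    by (simp add: poly_pcompose Xq_minus_X_def poly_monom)
  also have "\<dots> = x ^ (q ^ a) - x"
    by (simp add: pcompose_S_poly[OF assms] poly_monom)
  finally show ?thesis .
qed

lemma poly_S_poly_mult_GF:
  assumes "c \<in> GF q"
  shows "poly (S_poly q a) (c * x) = c * poly (S_poly q a) x"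
  by (simp add: poly_S_poly power_mult_distrib GF_power_power[OF assms] sum_distrib_left)

lemma poly_S_poly_GF:
  assumes "c \<in> GF q"
  shows "poly (S_poly q a) c = of_nat a * c"
  by (simp add: poly_S_poly GF_power_power[OF assms])

text \<open>For \<open>x\<close> in the field with \<open>q ^ e\<close> elements, the value of \<open>S\<^sub>e\<close> at \<open>x\<close> is the trace of \<open>x\<close>.\<close>

lemma trace_in_GF:
  fixes x :: "'p::field alg_closure"
  assumes "prime CHAR('p)" "q = CHAR('p) ^ m" "x \<in> GF (q ^ e)"
  shows "poly (S_poly q e) x \<in> GF q"
  using poly_S_poly_power_diff[of q m e x] assms by (simp add: GF_def)

text \<open>Each of the \<open>k\<close> summands \<open>x ^ (q ^ i)\<close> of \<open>S\<^sub>k(x)\<close> is a conjugate of \<open>x\<close> and has the same trace.\<close>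

lemma trace_S_poly:
  fixes x :: "'p::field alg_closure"
  assumes "prime CHAR('p)" "q = CHAR('p) ^ m" "x \<in> GF (q ^ e)"
  shows "poly (S_poly q e) (poly (S_poly q k) x) = of_nat k * poly (S_poly q e) x"
proof -
  have "poly (S_poly q e) (poly (S_poly q k) x) = (\<Sum>i<k. poly (S_poly q e) (x ^ (q ^ i)))"
    unfolding poly_S_poly[of q k] by (rule poly_S_poly_sum) (use assms in auto)
  also have "\<dots> = (\<Sum>i<k. poly (S_poly q e) x)"
  proof (rule sum.cong)
    fix i
    have "poly (S_poly q e) (x ^ (q ^ i)) = poly (S_poly q e) x ^ (q ^ i)"
      by (rule poly_S_poly_power[of _ "m * i"]) (use assms in \<open>simp_all add: power_mult\<close>)
    thus "poly (S_poly q e) (x ^ (q ^ i)) = poly (S_poly q e) x"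
      using GF_power_power[OF trace_in_GF[OF assms]] by simp
  qed auto
  finally show ?thesis by simp
qed

lemma poly_S_poly_in_GF:
  fixes x :: "'p::field alg_closure"
  assumes "prime CHAR('p)" "r = CHAR('p) ^ m" "x \<in> GF r"
  shows "poly (S_poly q a) x \<in> GF r"
  using poly_S_poly_power[of r m q a x] assms by (simp add: GF_def)

text \<open>The last \<open>k\<close> terms of \<open>S\<^sub>e\<^sub>+\<^sub>k\<close> form \<open>S\<^sub>k(X ^ (q ^ e))\<close>, and \<open>X ^ (q ^ e)\<close> reduces to \<open>X\<close>.\<close>

lemma S_poly_add_cong:
  "[S_poly q (e + k) = S_poly q e + S_poly q k] (mod (Xq_minus_X (q ^ e) :: 'a::field poly))"
proof -
  have "(\<Sum>i<e + k. monom 1 (q ^ i)) =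
      (\<Sum>i<e. monom 1 (q ^ i)) + (\<Sum>i<k. monom 1 (q ^ (e + i)) :: 'a poly)"
    by (induction k) (simp_all add: add.assoc)
  hence split: "S_poly q (e + k) = S_poly q e + (\<Sum>i<k. monom 1 (q ^ e) ^ (q ^ i) :: 'a poly)"
    by (simp add: S_poly_def monom_power power_add)
  have "[monom 1 (q ^ e) = monom 1 1] (mod (Xq_minus_X (q ^ e) :: 'a poly))"
    by (simp add: cong_iff_dvd_diff Xq_minus_X_def)
  hence "[(\<Sum>i<k. monom 1 (q ^ e) ^ (q ^ i)) = (\<Sum>i<k. monom 1 1 ^ (q ^ i))]
      (mod (Xq_minus_X (q ^ e) :: 'a poly))"
    by (intro cong_sum cong_pow)
  hence "[(\<Sum>i<k. monom 1 (q ^ e) ^ (q ^ i)) = S_poly q k] (mod (Xq_minus_X (q ^ e) :: 'a poly))"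
    by (simp add: S_poly_def monom_power)
  thus ?thesis unfolding split by (intro cong_add cong_refl)
qed

section \<open>The exact form of \<open>g\<close>\<close>

lemma two_eq_0_poly: "CHAR('a::comm_ring_1) = 2 \<Longrightarrow> (2 :: 'a poly) = 0"
  using of_nat_CHAR[where 'a = "'a poly"] by simp

lemma sum_powers_GF_4:
  assumes p: "CHAR('p) = 2" and j: "j \<le> 5"
  shows "(\<Sum>c\<in>GF 4. c ^ j) = (if j = 3 then 1 else 0 :: 'p::field alg_closure)"
proof -
  have pr: "prime CHAR('p)" "(4::nat) = CHAR('p) ^ 2" using p by auto
  have "(2 :: 'p alg_closure) = 0"
    using of_nat_CHAR[where 'a = "'p alg_closure"] p by simp
  hence m1: "(-1 :: 'p alg_closure) = 1" by (metis add_eq_0_iff one_add_one)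
  have small: "(\<Sum>c\<in>GF 4. c ^ i) = (0 :: 'p alg_closure)" if "i < 3" for i
    using sum_powers_GF[OF pr, of i] that by simp
  have "(\<Sum>c\<in>GF 4. c ^ 3) = (1 :: 'p alg_closure)"
    using sum_powers_GF_last[OF pr] m1 by simp
  \<comment> \<open>The exponents 4 and 5 reduce to 1 and 2 by \<open>c ^ 4 = c\<close>.\<close>
  moreover have "(\<Sum>c\<in>GF 4. c ^ (i + 4)) = (\<Sum>c\<in>GF 4. c ^ (i + 1) :: 'p alg_closure)" for i
    by (rule sum.cong) (auto simp: GF_def power_add mult.commute)
  note this[of 0] this[of 1]
  moreover have "j < 3 \<or> j = 3 \<or> j = 4 \<or> j = 5" using j by linarith
  ultimately show ?thesis using small[of 1] small[of 2] small[of j] by (auto simp flip: power2_eq_square)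
qed

text \<open>
  An exponent that is the sum of five powers of 4, one of them \<open>4 ^ 0\<close>, turns the sum over \<open>c\<close> into
  a sum of products of five linear factors. Of the coefficients \<open>e\<^sub>1, \<dots>, e\<^sub>5\<close> of such a product,
  only \<open>e\<^sub>2\<close> is multiplied by a nonvanishing power sum, that of exponent 3.
\<close>

lemma g_poly_digit_sum_5:
  fixes a b d f :: nat
  assumes p: "CHAR('p) = 2"
  defines "Sa \<equiv> S_poly 4 a" and "Sb \<equiv> S_poly 4 b" and "Sd \<equiv> S_poly 4 d" and "Sf \<equiv> S_poly 4 f"
  shows "(g_poly (1 + 4 ^ a + 4 ^ b + 4 ^ d + 4 ^ f) 4 :: 'p::field poly) =
      Sa * Sb + Sa * Sd + Sb * Sd + (Sa + Sb + Sd) * Sf"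
proof -
  let ?n = "1 + 4 ^ a + 4 ^ b + 4 ^ d + 4 ^ f :: nat"
  let ?F = "GF 4 :: 'p alg_closure set"
  have pr: "prime CHAR('p)" "(4::nat) = CHAR('p) ^ 2" using p by auto
  have prK: "prime CHAR('p alg_closure)" "(4::nat) = CHAR('p alg_closure) ^ 2" using p by auto
  define x :: "nat \<Rightarrow> 'p alg_closure poly" where "x i = monom 1 (4 ^ i)" for i
  have two: "(2 :: 'p alg_closure poly) = 0" using p by (intro two_eq_0_poly) simp

  have lin: "[:c, 1:] ^ (4 ^ i) = [:c:] + x i" if "c \<in> ?F" for c i
  proof -
    have "[:c, 1:] ^ (4 ^ i) = ([:c:] + monom 1 1) ^ (4 ^ i)" by (simp add: monom_altdef)
    also have "\<dots> = [:c:] ^ (4 ^ i) + monom 1 1 ^ (4 ^ i)"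
      by (rule freshmans_dream'[of _ "2 * i"]) (use prK in \<open>simp_all add: power_mult\<close>)
    finally show ?thesis
      using GF_power_power[OF that, of i] by (simp add: poly_const_pow monom_power x_def)
  qed

  define e1 where "e1 = x 0 + x a + x b + x d + x f"
  define e2 where "e2 = x 0 * x a + x 0 * x b + x 0 * x d + x 0 * x f + x a * x b + x a * x d
    + x a * x f + x b * x d + x b * x f + x d * x f"
  define e3 where "e3 = x 0 * x a * x b + x 0 * x a * x d + x 0 * x a * x f + x 0 * x b * x d
    + x 0 * x b * x f + x 0 * x d * x f + x a * x b * x d + x a * x b * x f + x a * x d * x f
    + x b * x d * x f"
  define e4 where "e4 = x 0 * x a * x b * x d + x 0 * x a * x b * x f + x 0 * x a * x d * x f
    + x 0 * x b * x d * x f + x a * x b * x d * x f"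
  define e5 where "e5 = x 0 * x a * x b * x d * x f"
  have vieta: "(C + x 0) * (C + x a) * (C + x b) * (C + x d) * (C + x f)
      = C ^ 5 + e1 * C ^ 4 + e2 * C ^ 3 + e3 * C ^ 2 + e4 * C ^ 1 + e5 * C ^ 0" for C
    unfolding e1_def e2_def e3_def e4_def e5_def
    by (simp add: algebra_simps power_numeral_reduce)
  have expand: "[:c, 1:] ^ ?n = [:c ^ 5:] + e1 * [:c ^ 4:] + e2 * [:c ^ 3:] + e3 * [:c ^ 2:]
      + e4 * [:c ^ 1:] + e5 * [:c ^ 0:]" if "c \<in> ?F" for c
  proof -
    have "[:c, 1:] ^ ?n = [:c, 1:] ^ (4 ^ 0) * [:c, 1:] ^ (4 ^ a) * [:c, 1:] ^ (4 ^ b)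
        * [:c, 1:] ^ (4 ^ d) * [:c, 1:] ^ (4 ^ f)"
      by (simp only: power_add power_0 power_one_right)
    also have "\<dots> = ([:c:] + x 0) * ([:c:] + x a) * ([:c:] + x b) * ([:c:] + x d) * ([:c:] + x f)"
      by (simp only: lin[OF that])
    also have "\<dots> = [:c:] ^ 5 + e1 * [:c:] ^ 4 + e2 * [:c:] ^ 3 + e3 * [:c:] ^ 2
        + e4 * [:c:] ^ 1 + e5 * [:c:] ^ 0"
      by (rule vieta)
    finally show ?thesis by (simp only: poly_const_pow)
  qed
  have const_sum: "(\<Sum>c\<in>?F. h * [:c ^ j:]) = h * [:\<Sum>c\<in>?F. c ^ j:]" for h j
    by (simp add: sum_distrib_left monom_sum flip: monom_0)
  have "(\<Sum>c\<in>?F. [:c, 1:] ^ ?n) = (\<Sum>c\<in>?F. 1 * [:c ^ 5:] + e1 * [:c ^ 4:] + e2 * [:c ^ 3:]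
      + e3 * [:c ^ 2:] + e4 * [:c ^ 1:] + e5 * [:c ^ 0:])"
    by (rule sum.cong) (simp_all only: expand mult_1)
  also have "\<dots> = e2"
    by (simp only: sum.distrib const_sum sum_powers_GF_4[OF p]) (simp add: sum_powers_GF_4[OF p])
  \<comment> \<open>The translation by \<open>x 0 = X\<close>; the last summand collects the even coefficients.\<close>
  also have "e2 = (x a - x 0) * (x b - x 0) + (x a - x 0) * (x d - x 0) + (x b - x 0) * (x d - x 0)
      + ((x a - x 0) + (x b - x 0) + (x d - x 0)) * (x f - x 0)
      + 2 * (2 * x 0 * (x a + x b + x d + x f) - 3 * x 0 * x 0)"
    unfolding e2_def by (simp add: algebra_simps)
  also have "\<dots> = pcompose (lift_ac (Sa * Sb + Sa * Sd + Sb * Sd + (Sa + Sb + Sd) * Sf)) (Xq_minus_X 4)"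
    by (simp add: Sa_def Sb_def Sd_def Sf_def lift_ac_mult lift_ac_S_poly pcompose_add pcompose_mult
        pcompose_S_poly[OF prK] x_def two)
  finally show ?thesis
    unfolding g_poly_def by (intro the1_equality ex1_g_poly[OF pr]) simp_all
qed

section \<open>The permutation property\<close>

text \<open>
  The field is finite and closed under the map, so injectivity suffices. Equal values have equal
  traces, which forces the arguments to have the same trace \<open>t\<close>; then their values of \<open>S\<^sub>k\<close> differ
  by 0 or \<open>t\<close>, an element of the field with \<open>q\<close> elements.
\<close>

lemma bij_S_poly_quadratic:
  fixes q e k m :: nat
  assumes p: "CHAR('p) = 2" and q: "q = 2 ^ m" and m: "m > 0"
    and e: "odd e" and k: "k > 0" and co: "coprime k e"
  shows "bij_betw (\<lambda>x. poly (S_poly q k) x ^ 2 + poly (S_poly q e) x * poly (S_poly q k) x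
           + poly (S_poly q e) x ^ 2)
         (GF (q ^ e)) (GF (q ^ e) :: 'p::field alg_closure set)"
    (is "bij_betw ?f ?F ?F")
proof -
  let ?T = "poly (S_poly q e) :: 'p alg_closure \<Rightarrow> _"
  let ?S = "poly (S_poly q k) :: 'p alg_closure \<Rightarrow> _"
  have pr: "prime CHAR('p)" "q = CHAR('p) ^ m" using p q by auto
  have prK: "prime CHAR('p alg_closure)" "q = CHAR('p alg_closure) ^ m" using p q by auto
  have Q: "q ^ e = CHAR('p) ^ (m * e)" using pr by (simp add: power_mult)
  have e0: "e > 0" using e by (cases e) auto
  have two: "(2 :: 'p alg_closure) = 0"
    using of_nat_CHAR[where 'a = "'p alg_closure"] p by simp
  obtain u where "e = 2 * u + 1" using e by (elim oddE)
  hence e1: "of_nat e = (1 :: 'p alg_closure)" using two by simp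

  have closed: "?f x \<in> ?F" if "x \<in> ?F" for x
  proof -
    have "?S x \<in> ?F" "?T x \<in> ?F"
      using poly_S_poly_in_GF[OF pr(1) Q that] by auto
    thus ?thesis
      unfolding power2_eq_square by (intro GF_closed(3,5)[OF pr(1) Q])
  qed

  have trace_square: "?T (y ^ 2) = ?T y ^ 2" for y
    by (rule poly_S_poly_power[of _ 1]) (use p in auto)
  have trace: "?T (?f x) = ?T x ^ 2" if "x \<in> ?F" for x
  proof -
    define t where "t = ?T x"
    have t: "t \<in> GF q" unfolding t_def by (rule trace_in_GF[OF pr that])
    have Tt: "?T t = t" using poly_S_poly_GF[OF t, of e] e1 by simp
    have TS: "?T (?S x) = of_nat k * t" using trace_S_poly[OF pr that, of k] by (simp add: t_def)
    \<comment> \<open>As \<open>k\<^sup>2\<close> and \<open>k\<close> have the same parity, the contributions of \<open>S\<^sub>k(x)\<^sup>2\<close> and \<open>t S\<^sub>k(x)\<close> cancel.\<close>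
    have "(of_nat k :: 'p alg_closure) = 0 \<or> of_nat k = (1 :: 'p alg_closure)"
      using two by (cases "even k") (auto elim!: evenE oddE)
    hence "(of_nat k * t) ^ 2 + t * (of_nat k * t) + t ^ 2 = t ^ 2"
      using two by (elim disjE) (simp_all add: power2_eq_square flip: mult_2)
    thus ?thesis
      by (simp add: poly_S_poly_add[OF prK] trace_square poly_S_poly_mult_GF[OF t] TS Tt flip: t_def)
  qed

  have inj: "inj_on ?f ?F"
  proof (rule inj_onI)
    fix x y assume x: "x \<in> ?F" and y: "y \<in> ?F" and xy: "?f x = ?f y"
    have "?T x ^ 2 = ?T y ^ 2" using trace[OF x] trace[OF y] xy by simp
    moreover have "- ?T y = ?T y" using two by (metis add_eq_0_iff mult_2 mult_zero_left)
    ultimately have Txy: "?T x = ?T y" by (auto simp: power2_eq_iff)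
    define z where "z = x - y"
    have "- y \<in> ?F" by (rule GF_closed(4)[OF pr(1) Q y y])
    hence z: "z \<in> ?F" using GF_closed(3)[OF pr(1) Q x] by (force simp: z_def)
    have Tz: "?T z = 0" by (simp add: z_def poly_S_poly_diff[OF prK] Txy)
    have Sz: "?S z = ?S x - ?S y" by (simp add: z_def poly_S_poly_diff[OF prK])
    \<comment> \<open>In characteristic 2 the map \<open>s \<mapsto> s\<^sup>2 + t s\<close> is additive, so its equal values at \<open>S\<^sub>k(x)\<close>
      and \<open>S\<^sub>k(y)\<close> give the value 0 at the difference.\<close>
    have "?S z * (?S z + ?T x) = ?f x - (?S y ^ 2 + ?T x * ?S y + ?T x ^ 2) - 2 * ?S z * ?S y"
      unfolding Sz by (simp add: algebra_simps power2_eq_square)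
    hence "?S z * (?S z + ?T x) = 0" using xy Txy two by simp
    hence "?S z = 0 \<or> ?S z = - ?T x" by (auto simp: add_eq_0_iff2)
    hence "?S z \<in> GF q"
      using trace_in_GF[OF pr x] GF_closed(1,4)[OF pr, of "?T x" "?T x"] by auto
    hence "z \<in> GF (q ^ k)"
      using poly_S_poly_power_diff[OF prK, of k z] by (simp add: GF_def)
    hence "z \<in> GF q" using GF_power_Int_coprime[OF co k] z by blast
    hence "?T z = z" using poly_S_poly_GF[of z q e] e1 by simp
    thus "x = y" using Tz by (simp add: z_def)
  qed
  have "finite ?F" using card_GF(1)[OF pr(1) Q] m e0 by simp
  thus ?thesis
    unfolding bij_betw_def using inj closed by (intro conjI endo_inj_surj) auto
qed

lemma poly_lift_ac_cong:
  fixes f g :: "'p::field poly"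
  assumes "[f = g] (mod Xq_minus_X q)" "x \<in> GF q"
  shows "poly (lift_ac f) x = poly (lift_ac g) x"
proof -
  obtain h where "f - g = Xq_minus_X q * h"
    using assms(1) by (auto simp: cong_iff_dvd_diff elim: dvdE)
  hence "f = g + Xq_minus_X q * h" by (simp add: algebra_simps)
  thus ?thesis
    using assms(2) by (simp add: lift_ac_mult lift_ac_Xq_minus_X GF_eq_roots)
qed

theorem proposition3p3:
  fixes q n a b e k :: nat
  assumes q: "q = 4"
    and pos: "a > 0" "b > 0" "e > 0" "k > 0"
    and n: "n = 1 + q ^ a + q ^ b + q ^ e + q ^ (e + k)"
  shows "[(g_poly n q :: bit poly) =
            S_poly q a * S_poly q b
            + (S_poly q a + S_poly q b + S_poly q e) * S_poly q k
            + S_poly q e ^ 2] (mod Xq_minus_X (q ^ e))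
         \<and> (gcd e (2 * k) = 1 \<and> (a = k \<or> b = k) \<longrightarrow>
              permutation_poly_on (GF (q ^ e)) (lift_ac (g_poly n q :: bit poly)))"
proof (intro conjI impI)
  let ?S = "S_poly q :: nat \<Rightarrow> bit poly"
  let ?R = "?S a * ?S b + (?S a + ?S b + ?S e) * ?S k + ?S e ^ 2"
  have two: "(2 :: bit poly) = 0" by (rule two_eq_0_poly) (rule CHAR_bit)
  have "g_poly n q = ?S a * ?S b + ?S a * ?S e + ?S b * ?S e + (?S a + ?S b + ?S e) * ?S (e + k)"
    using g_poly_digit_sum_5[OF CHAR_bit, of a b e "e + k"] by (simp add: n q)
  also have "[\<dots> = ?S a * ?S b + ?S a * ?S e + ?S b * ?S e + (?S a + ?S b + ?S e) * (?S e + ?S k)]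
      (mod Xq_minus_X (q ^ e))"
    by (intro cong_add cong_mult cong_refl S_poly_add_cong)
  also have "?S a * ?S b + ?S a * ?S e + ?S b * ?S e + (?S a + ?S b + ?S e) * (?S e + ?S k)
      = ?R + 2 * (?S a * ?S e + ?S b * ?S e)"
    by (simp add: algebra_simps power2_eq_square)
  finally show cong: "[g_poly n q = ?R] (mod Xq_minus_X (q ^ e))" by (simp add: two)

  assume "gcd e (2 * k) = 1 \<and> (a = k \<or> b = k)"
  hence co: "coprime e (2 * k)" and ab: "a = k \<or> b = k"
    by (auto simp: coprime_iff_gcd_eq_1)
  have "bij_betw (\<lambda>x. poly (S_poly q k) x ^ 2 + poly (S_poly q e) x * poly (S_poly q k) x
      + poly (S_poly q e) x ^ 2) (GF (q ^ e)) (GF (q ^ e) :: bit alg_closure set)"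
    by (rule bij_S_poly_quadratic[where m = 2]) (use co pos q in \<open>auto simp: CHAR_bit coprime_commute\<close>)
  moreover have "?R = ?S k ^ 2 + ?S e * ?S k + ?S e ^ 2 + 2 * (?S a * ?S b)"
    using ab by (auto simp: algebra_simps power2_eq_square)
  hence "?R = ?S k ^ 2 + ?S e * ?S k + ?S e ^ 2" by (simp add: two)
  hence "poly (lift_ac (g_poly n q :: bit poly)) x = poly (S_poly q k) x ^ 2
      + poly (S_poly q e) x * poly (S_poly q k) x + poly (S_poly q e) x ^ 2"
    if "x \<in> GF (q ^ e)" for x
    using poly_lift_ac_cong[OF cong that]
    by (simp add: lift_ac_mult lift_ac_S_poly power2_eq_square)
  ultimately show "permutation_poly_on (GF (q ^ e)) (lift_ac (g_poly n q :: bit poly))"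
    unfolding permutation_poly_on_def by (simp cong: bij_betw_cong)
qed

end
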